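(* For every $C_{-1}\in\mathbb{R}$, the surface $\left(\mathbb{R}^2,\ \tilde g_{C_{-1}}(\omega,\theta)=\Gamma^2(\omega)\,d\theta^2+d\omega^2\right)$ is complete, where $\Gamma:\mathbb{R}\to\mathbb{R}$ is given by $$\Gamma(\omega)=\begin{cases} h(\omega), & \omega>0,\\ \dfrac{1}{\xi_{01}}, & \omega=0,\\ h(-\omega), & \omega<0,\end{cases}$$ and the number $\xi_{01}>0$ and the function $h:(0,\infty)\to(0,\infty)$ (both depending on $C_{-1}$) are as defined in the context.
   Context: Fix $C_{-1}\in\mathbb{R}$. Let $T(\xi)=-\xi^{8/3}+C_{-1}\xi^2+3$ for $\xi>0$, and let $\xi_{01}>0$ be the unique positive zero of $T$; one has $T>0$ on $(0,\xi_{01})$. Fix an arbitrary $\xi_{00}\in(0,\xi_{01})$ and define $$\rho:(0,\xi_{01})\to\mathbb{R},\qquad \rho(\xi)=-\int_{\xi_{00}}^{\xi}\sqrt{\frac{3}{\tau^2\left(-\tau^{8/3}+C_{-1}\tau^2+3\right)}}\,d\tau .$$ The function $\rho$ is strictly decreasing, $\lim_{\xi\searrow 0}\rho(\xi)=\infty$ and $\lim_{\xi\nearrow\xi_{01}}\rho(\xi)=\rho_1\in(-\infty,0)$. Let $\xi=\xi(\rho)$, $\rho\in(\rho_1,\infty)$, be its inverse function. Define $h:(0,\infty)\to(0,\infty)$ by $$h(\omega)=\frac{1}{\xi(\omega+\rho_1)} .$$ (The metric $h^2(\omega)d\theta^2+d\omega^2$ on $(0,\infty)\times\mathbb{R}$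 is, after the change of coordinates $\omega=\rho(\xi)-\rho_1$, the metric $\frac{1}{\xi^2}\left(\frac{3}{-\xi^{8/3}+C_{-1}\xi^2+3}d\xi^2+d\theta^2\right)$ on $(0,\xi_{01})\times\mathbb{R}$.) *)

theory Defs
  imports "HOL-Analysis.Analysis"
begin

section \<open>Riemannian metrics on a Euclidean space and their completeness\<close>

text \<open>
  \<^term>\<open>frechet_derivative f (at x) b\<close> is the partial derivative of \<^term>\<open>f\<close> at \<^term>\<open>x\<close>
  in the direction of the basis vector \<^term>\<open>b\<close>.
\<close>

primrec times_cont_diff :: "nat \<Rightarrow> ('a::euclidean_space \<Rightarrow> real) \<Rightarrow> bool" where
  "times_cont_diff 0 f \<longleftrightarrow> continuous_on UNIV f"
| "times_cont_diff (Suc k) f \<longleftrightarrow>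
     (\<forall>x. f differentiable (at x)) \<and>
     (\<forall>b\<in>Basis. times_cont_diff k (\<lambda>x. frechet_derivative f (at x) b))"

definition smooth_fun :: "('a::euclidean_space \<Rightarrow> real) \<Rightarrow> bool" where
  "smooth_fun f \<longleftrightarrow> (\<forall>k. times_cont_diff k f)"

text \<open>
  The manifold is the whole space \<^typ>\<open>'a\<close> with its single global chart, so every tangent space
  is \<^typ>\<open>'a\<close> itself, and \<^term>\<open>g p u v\<close> is the value of the metric at the point \<^term>\<open>p\<close> on
  the tangent vectors \<^term>\<open>u\<close> and \<^term>\<open>v\<close>.
\<close>

definition riemannian_metric :: "('a::euclidean_space \<Rightarrow> 'a \<Rightarrow> 'a \<Rightarrow> real) \<Rightarrow> bool" where
  "riemannian_metric g \<longleftrightarrow>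
     (\<forall>p. bilinear (g p)) \<and>
     (\<forall>p u v. g p u v = g p v u) \<and>
     (\<forall>p v. v \<noteq> 0 \<longrightarrow> 0 < g p v v) \<and>
     (\<forall>u v. smooth_fun (\<lambda>p. g p u v))"

definition C1_curve_on :: "real \<Rightarrow> real \<Rightarrow> (real \<Rightarrow> 'a::real_normed_vector) \<Rightarrow> bool" where
  "C1_curve_on a b c \<longleftrightarrow>
     (\<exists>c'. continuous_on {a..b} c' \<and>
           (\<forall>t\<in>{a..b}. (c has_vector_derivative c' t) (at t within {a..b})))"

text \<open>
  Each piece has to be continuously differentiable up to its endpoints, in contrast to
  \<^const>\<open>piecewise_C1_differentiable_on\<close>, which puts no condition on the derivative near the
  exceptional points. Hence the speed below is always integrable; otherwise a curve of infinite
  length could get the value 0 of a non-existing integral.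
\<close>

definition piecewise_C1_curve :: "(real \<Rightarrow> 'a::real_normed_vector) \<Rightarrow> bool" where
  "piecewise_C1_curve c \<longleftrightarrow>
     (\<exists>(n::nat) s. s 0 = 0 \<and> s n = 1 \<and>
        (\<forall>i<n. s i < s (Suc i) \<and> C1_curve_on (s i) (s (Suc i)) c))"

definition riemannian_length ::
    "('a::euclidean_space \<Rightarrow> 'a \<Rightarrow> 'a \<Rightarrow> real) \<Rightarrow> (real \<Rightarrow> 'a) \<Rightarrow> real" where
  "riemannian_length g c =
     integral {0..1} (\<lambda>t. sqrt (g (c t) (vector_derivative c (at t)) (vector_derivative c (at t))))"

definition riemannian_dist ::
    "('a::euclidean_space \<Rightarrow> 'a \<Rightarrow> 'a \<Rightarrow> real) \<Rightarrow> 'a \<Rightarrow> 'a \<Rightarrow> real" where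
  "riemannian_dist g p q =
     Inf {riemannian_length g c | c. piecewise_C1_curve c \<and> c 0 = p \<and> c 1 = q}"

definition complete_riemannian_metric ::
    "('a::euclidean_space \<Rightarrow> 'a \<Rightarrow> 'a \<Rightarrow> real) \<Rightarrow> bool" where
  "complete_riemannian_metric g \<longleftrightarrow>
     riemannian_metric g \<and> Metric_space.mcomplete UNIV (riemannian_dist g)"


section \<open>The profile function and the surface\<close>

definition T_fun :: "real \<Rightarrow> real \<Rightarrow> real" where
  "T_fun C x = - (x powr (8/3)) + C * x\<^sup>2 + 3"

definition xi01 :: "real \<Rightarrow> real" where
  "xi01 C = (THE x. 0 < x \<and> T_fun C x = 0)"

text \<open>Only the values for \<^term>\<open>x\<close> and \<^term>\<open>xi00\<close> in \<^term>\<open>{0<..<xi01 C}\<close> are meaningful.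
  The integral is oriented: it changes sign for \<^term>\<open>x < xi00\<close>.\<close>

definition rho :: "real \<Rightarrow> real \<Rightarrow> real \<Rightarrow> real" where
  "rho C xi00 x = - (LBINT \<tau>=xi00..x. sqrt (3 / (\<tau>\<^sup>2 * T_fun C \<tau>)))"

definition rho1 :: "real \<Rightarrow> real \<Rightarrow> real" where
  "rho1 C xi00 = Lim (at_left (xi01 C)) (rho C xi00)"

definition xi_of_rho :: "real \<Rightarrow> real \<Rightarrow> real \<Rightarrow> real" where
  "xi_of_rho C xi00 = the_inv_into {0<..<xi01 C} (rho C xi00)"

definition h_fun :: "real \<Rightarrow> real \<Rightarrow> real \<Rightarrow> real" where
  "h_fun C xi00 \<omega> = 1 / xi_of_rho C xi00 (\<omega> + rho1 C xi00)"

definition Gamma_fun :: "real \<Rightarrow> real \<Rightarrow> real \<Rightarrow> real" where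
  "Gamma_fun C xi00 \<omega> =
     (if \<omega> > 0 then h_fun C xi00 \<omega>
      else if \<omega> = 0 then 1 / xi01 C
      else h_fun C xi00 (- \<omega>))"

text \<open>Points and tangent vectors are written in the coordinates \<open>(\<omega>, \<theta>)\<close>.\<close>

definition g_tilde :: "real \<Rightarrow> real \<Rightarrow> real \<times> real \<Rightarrow> real \<times> real \<Rightarrow> real \<times> real \<Rightarrow> real" where
  "g_tilde C xi00 p u v = (Gamma_fun C xi00 (fst p))\<^sup>2 * (snd u * snd v) + fst u * fst v"

end

theory Submission
  imports Defs
begin

text \<open>
  Put \<open>G = 1 / \<xi>\<close> as a function of \<open>\<omega>\<close>. Then \<open>(G')\<^sup>2 = (3 G\<^sup>2 + C - G powr (- 2/3)) / 3\<close>, whose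
  right-hand side vanishes at \<open>1 / \<xi>\<^sub>0\<^sub>1\<close>. Differentiating, the even extension \<open>\<Gamma>\<close> solves
  \<open>G'' = G + G powr (- 5/3) / 9\<close> on the whole line, with \<open>G' = 0\<close> at the origin, and is
  therefore smooth. Moreover \<open>\<Gamma> \<ge> 1 / \<xi>\<^sub>0\<^sub>1\<close>, so the metric dominates a positive multiple of the
  Euclidean one: Cauchy sequences for its distance are Euclidean Cauchy sequences, and Euclidean
  convergence implies convergence for its distance because the metric is locally bounded.
\<close>

section \<open>Piecewise continuously differentiable curves\<close>

text \<open>An index-free form of the partition in \<open>piecewise_C1_curve\<close>: facts about
  single pieces extend by induction, and concatenation of curves becomes a rule.\<close>

inductive pw_C1_on :: "(real \<Rightarrow> 'a::real_normed_vector) \<Rightarrow> real \<Rightarrow> real \<Rightarrow> bool" for c where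
  piece: "a < b \<Longrightarrow> C1_curve_on a b c \<Longrightarrow> pw_C1_on c a b"
| join: "pw_C1_on c a b \<Longrightarrow> pw_C1_on c b d \<Longrightarrow> pw_C1_on c a d"

lemma pw_C1_on_less: "pw_C1_on c a b \<Longrightarrow> a < b"
  by (induction rule: pw_C1_on.induct) auto

lemma pw_C1_on_partition:
  assumes "\<forall>i<n. s i < s (Suc i) \<and> C1_curve_on (s i) (s (Suc i)) c" "0 < n"
  shows "pw_C1_on c (s 0) (s n)"
  using assms
proof (induction n)
  case (Suc n)
  have last: "pw_C1_on c (s n) (s (Suc n))"
    using Suc.prems by (intro piece) auto
  show ?case
  proof (cases "n = 0")
    case True
    then show ?thesis using last by simp
  next
    case False
    then have "pw_C1_on c (s 0) (s n)"
      using Suc by auto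
    then show ?thesis using last by (rule join)
  qed
qed simp

lemma pw_C1_on_imp_partition:
  assumes "pw_C1_on c a b"
  shows "\<exists>(n::nat) s. s 0 = a \<and> s n = b \<and>
           (\<forall>i<n. s i < s (Suc i) \<and> C1_curve_on (s i) (s (Suc i)) c)"
  using assms
proof (induction rule: pw_C1_on.induct)
  case (piece a b)
  then show ?case
    by (intro exI[of _ 1] exI[of _ "\<lambda>i. if i = 0 then a else b"]) auto
next
  case (join a b d)
  then obtain m n :: nat and s t where s: "s 0 = a" "s m = b"
      "\<forall>i<m. s i < s (Suc i) \<and> C1_curve_on (s i) (s (Suc i)) c"
    and t: "t 0 = b" "t n = d" "\<forall>i<n. t i < t (Suc i) \<and> C1_curve_on (t i) (t (Suc i)) c"
    by metis
  \<comment> \<open>The second partition is shifted by \<open>m\<close>. At index \<open>m\<close>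
    both have the value \<open>b\<close>, so the two branches fit together there.\<close>
  define r where "r i = (if i \<le> m then s i else t (i - m))" for i
  have "r i < r (Suc i) \<and> C1_curve_on (r i) (r (Suc i)) c" if "i < m + n" for i
  proof (cases "i < m")
    case True
    then show ?thesis using s by (simp add: r_def)
  next
    case False
    then have "r i = t (i - m)" "r (Suc i) = t (Suc (i - m))"
      using s t by (auto simp: r_def Suc_diff_le)
    then show ?thesis using t that False by simp
  qed
  moreover have "r 0 = a" "r (m + n) = d"
    using s t by (auto simp: r_def)
  ultimately show ?case by metis
qed

lemma piecewise_C1_curve_iff: "piecewise_C1_curve c \<longleftrightarrow> pw_C1_on c 0 1"
proof
  assume "piecewise_C1_curve c"
  then obtain n :: nat and s where s: "s 0 = 0" "s n = 1"
      "\<forall>i<n. s i < s (Suc i) \<and> C1_curve_on (s i) (s (Suc i)) c"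
    unfolding piecewise_C1_curve_def by blast
  then have "0 < n" by (metis gr0I zero_neq_one)
  then show "pw_C1_on c 0 1" using pw_C1_on_partition[OF s(3)] s by simp
next
  assume "pw_C1_on c 0 1"
  then show "piecewise_C1_curve c"
    unfolding piecewise_C1_curve_def by (rule pw_C1_on_imp_partition)
qed

section \<open>Reparametrisation and differentiability of piecewise curves\<close>

lemma C1_curve_on_cong:
  assumes "C1_curve_on a b c" "\<And>t. t \<in> {a..b} \<Longrightarrow> c t = d t"
  shows "C1_curve_on a b d"
  using assms unfolding C1_curve_on_def
  by (metis (no_types, lifting) has_vector_derivative_transform)

lemma pw_C1_on_cong:
  assumes "pw_C1_on c a b" "\<And>t. t \<in> {a..b} \<Longrightarrow> c t = d t"
  shows "pw_C1_on d a b"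
  using assms
proof (induction rule: pw_C1_on.induct)
  case (piece a b)
  then show ?case by (metis C1_curve_on_cong pw_C1_on.piece)
next
  case (join a b e)
  then have "a < b" "b < e" by (auto dest: pw_C1_on_less)
  with join have "pw_C1_on d a b" "pw_C1_on d b e" by auto
  then show ?case by (rule pw_C1_on.join)
qed

lemma C1_curve_on_affine:
  assumes "C1_curve_on a b c" "(\<lambda>t. m * t + k) ` {p..q} \<subseteq> {a..b}"
  shows "C1_curve_on p q (\<lambda>t. c (m * t + k))"
proof -
  from assms(1) obtain c' where c': "continuous_on {a..b} c'"
    "\<And>t. t \<in> {a..b} \<Longrightarrow> (c has_vector_derivative c' t) (at t within {a..b})"
    unfolding C1_curve_on_def by blast
  have "continuous_on {p..q} (\<lambda>t. m *\<^sub>R c' (m * t + k))"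
    using assms(2) by (intro continuous_intros continuous_on_compose2[OF c'(1)])
  moreover have "((\<lambda>t. c (m * t + k)) has_vector_derivative m *\<^sub>R c' (m * t + k)) (at t within {p..q})"
    if t: "t \<in> {p..q}" for t
  proof -
    have 1: "((\<lambda>t. m * t + k) has_vector_derivative m) (at t within {p..q})"
      by (auto intro!: derivative_eq_intros)
    have 2: "(c has_vector_derivative c' (m * t + k)) (at (m * t + k) within (\<lambda>t. m * t + k) ` {p..q})"
      by (rule has_vector_derivative_within_subset[OF c'(2) assms(2)])
        (rule subsetD[OF assms(2) imageI[OF t]])
    from vector_diff_chain_within[OF 1 2] show ?thesis by (simp add: o_def)
  qed
  ultimately show ?thesis unfolding C1_curve_on_def by blast
qed

lemma pw_C1_on_affine_pos:
  assumes "pw_C1_on c a b" "0 < m"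
  shows "pw_C1_on (\<lambda>t. c (m * t + k)) ((a - k) / m) ((b - k) / m)"
  using assms
proof (induction rule: pw_C1_on.induct)
  case (piece a b)
  then show ?case
    by (intro pw_C1_on.piece C1_curve_on_affine[OF piece(2)]) (auto simp: field_simps)
next
  case (join a b d)
  then show ?case by (blast intro: pw_C1_on.join)
qed

text \<open>A negative slope swaps the endpoints; this serves for reversing a curve, while the
  positive case serves for the halves of a concatenation.\<close>

lemma pw_C1_on_affine_neg:
  assumes "pw_C1_on c a b" "m < 0"
  shows "pw_C1_on (\<lambda>t. c (m * t + k)) ((b - k) / m) ((a - k) / m)"
  using assms
proof (induction rule: pw_C1_on.induct)
  case (piece a b)
  then show ?case
    by (intro pw_C1_on.piece C1_curve_on_affine[OF piece(2)]) (auto simp: field_simps)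
next
  case (join a b d)
  then show ?case by (blast intro: pw_C1_on.join)
qed

text \<open>Inside a piece the derivative within the interval is the two-sided one, so only
  partition points are exceptional.\<close>

lemma pw_C1_on_differentiable:
  assumes "pw_C1_on c a b"
  shows "\<exists>S. finite S \<and> (\<forall>t\<in>{a..b} - S. c differentiable (at t))"
  using assms
proof (induction rule: pw_C1_on.induct)
  case (piece a b)
  then obtain c' where c': "\<And>t. t \<in> {a..b} \<Longrightarrow> (c has_vector_derivative c' t) (at t within {a..b})"
    unfolding C1_curve_on_def by blast
  have "c differentiable (at t)" if "t \<in> {a..b} - {a, b}" for t
    using c'[of t] that at_within_Icc_at[of a t b] by (auto intro: differentiableI_vector)
  then show ?case by (intro exI[of _ "{a, b}"]) blast
next
  case (join a b d)
  then obtain S T where "finite S" "\<forall>t\<in>{a..b} - S. c differentiable (at t)"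
    "finite T" "\<forall>t\<in>{b..d} - T. c differentiable (at t)"
    by blast
  then show ?case by (intro exI[of _ "S \<union> T"]) (metis Un_iff DiffD1 DiffD2 DiffI
        atLeastAtMost_iff finite_UnI linear)
qed

section \<open>Metrics dominating a multiple of the Euclidean one\<close>

text \<open>The integrand of \<open>riemannian_length\<close>. At corners of a curve its value is
  arbitrary, but these are finitely many points and do not affect integrals.\<close>

definition speed :: "('a::euclidean_space \<Rightarrow> 'a \<Rightarrow> 'a \<Rightarrow> real) \<Rightarrow> (real \<Rightarrow> 'a) \<Rightarrow> real \<Rightarrow> real" where
  "speed g c t = sqrt (g (c t) (vector_derivative c (at t)) (vector_derivative c (at t)))"

lemma riemannian_length_speed: "riemannian_length g c = integral {0..1} (speed g c)"
  by (simp add: riemannian_length_def speed_def[abs_def])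

lemma speed_affine:
  assumes "bilinear (g (c (m * t + k)))" "c differentiable (at (m * t + k))"
  shows "speed g (\<lambda>t. c (m * t + k)) t = \<bar>m\<bar> * speed g c (m * t + k)"
proof -
  have 1: "((\<lambda>t. m * t + k) has_vector_derivative m) (at t)"
    by (auto intro!: derivative_eq_intros)
  have 2: "(c has_vector_derivative vector_derivative c (at (m * t + k))) (at (m * t + k))"
    using assms(2) by (simp add: vector_derivative_works)
  have "vector_derivative (\<lambda>t. c (m * t + k)) (at t) = m *\<^sub>R vector_derivative c (at (m * t + k))"
    using vector_diff_chain_at[OF 1 2] by (auto simp: o_def intro: vector_derivative_at)
  then show ?thesis
    using assms(1)
    by (simp add: speed_def bilinear_lmul bilinear_rmul real_sqrt_mult flip: mult.assoc)
qed

text \<open>The factor \<open>\<bar>m\<bar>\<close> from the chain rule cancels the one from the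
  substitution. Writing the new interval as an image covers both signs of \<open>m\<close>.\<close>

lemma speed_affine_has_integral:
  assumes "\<And>p. bilinear (g p)" "pw_C1_on c a b" "m \<noteq> 0" "(speed g c has_integral i) {a..b}"
  shows "(speed g (\<lambda>t. c (m * t + k)) has_integral i) ((\<lambda>t. (t - k) / m) ` {a..b})"
proof -
  obtain S where S: "finite S" "\<forall>t\<in>{a..b} - S. c differentiable (at t)"
    using pw_C1_on_differentiable[OF assms(2)] by blast
  have "((\<lambda>t. speed g c (m *\<^sub>R t + k)) has_integral (1 / (\<bar>m\<bar> ^ DIM(real))) *\<^sub>R i)
         ((\<lambda>t. (1 / m) *\<^sub>R t + - ((1 / m) *\<^sub>R k)) ` cbox a b)"
    by (rule has_integral_affinity) (use assms in auto)
  moreover have "(\<lambda>t. (1 / m) *\<^sub>R t + - ((1 / m) *\<^sub>R k)) = (\<lambda>t. (t - k) / m)"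
    by (auto simp: diff_divide_distrib)
  ultimately have "((\<lambda>t. speed g c (m * t + k)) has_integral i / \<bar>m\<bar>) ((\<lambda>t. (t - k) / m) ` {a..b})"
    by (simp add: diff_divide_distrib)
  from has_integral_mult_right[OF this, of "\<bar>m\<bar>"]
  have int: "((\<lambda>t. \<bar>m\<bar> * speed g c (m * t + k)) has_integral i) ((\<lambda>t. (t - k) / m) ` {a..b})"
    using \<open>m \<noteq> 0\<close> by simp
  show ?thesis
  proof (rule has_integral_spike_finite[OF _ _ int])
    show "finite ((\<lambda>t. (t - k) / m) ` S)" using S by simp
    fix t assume t: "t \<in> (\<lambda>t. (t - k) / m) ` {a..b} - (\<lambda>t. (t - k) / m) ` S"
    then have "m * t + k \<in> {a..b} - S"
      using \<open>m \<noteq> 0\<close> by (auto simp: image_iff field_simps)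
    then show "speed g (\<lambda>t. c (m * t + k)) t = \<bar>m\<bar> * speed g c (m * t + k)"
      using S assms by (intro speed_affine) auto
  qed
qed

lemma speed_has_integral_cong:
  assumes "(speed g c has_integral i) {a..b}" "\<And>t. t \<in> {a..b} \<Longrightarrow> c t = d t"
  shows "(speed g d has_integral i) {a..b}"
proof (rule has_integral_spike_finite[OF _ _ assms(1)])
  \<comment> \<open>The endpoints are left out because \<open>c\<close> and \<open>d\<close> may
    differ beyond them, and then so may their two-sided derivatives.\<close>
  fix t assume t: "t \<in> {a..b} - {a, b}"
  then have "eventually (\<lambda>x. x \<in> {a<..<b}) (nhds t)"
    by (intro eventually_nhds_in_open) auto
  then have ev: "eventually (\<lambda>x. c x = d x) (nhds t)"
    by eventually_elim (use assms(2) in auto)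
  have "(c has_vector_derivative v) (at t) \<longleftrightarrow> (d has_vector_derivative v) (at t)" for v
    using ev t assms(2) by (intro has_vector_derivative_cong_ev) (auto elim: eventually_mono)
  then have "vector_derivative c (at t) = vector_derivative d (at t)"
    by (simp add: vector_derivative_def)
  then show "speed g d t = speed g c t"
    using t assms(2) by (simp add: speed_def)
qed auto

lemma bilinear_eq_sum:
  fixes B :: "'a::euclidean_space \<Rightarrow> 'a \<Rightarrow> real"
  assumes "bilinear B"
  shows "B u v = (\<Sum>i\<in>Basis. \<Sum>j\<in>Basis. (u \<bullet> i) * (v \<bullet> j) * B i j)"
proof -
  have "B u v = B (\<Sum>i\<in>Basis. (u \<bullet> i) *\<^sub>R i) (\<Sum>j\<in>Basis. (v \<bullet> j) *\<^sub>R j)"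
    by (simp add: euclidean_representation)
  also have "\<dots> = (\<Sum>(i, j)\<in>Basis \<times> Basis. B ((u \<bullet> i) *\<^sub>R i) ((v \<bullet> j) *\<^sub>R j))"
    by (rule bilinear_sum[OF assms])
  finally show ?thesis
    using assms by (simp add: sum.cartesian_product bilinear_lmul bilinear_rmul mult_ac)
qed

text \<open>A metric is assumed smooth only for fixed tangent vectors. Expanding in the basis
  reduces joint continuity to that of finitely many coefficients.\<close>

lemma continuous_on_riemannian_metric:
  assumes g: "riemannian_metric g"
    and "continuous_on S c" "continuous_on S u" "continuous_on S v"
  shows "continuous_on S (\<lambda>t. g (c t) (u t) (v t))"
proof -
  have "continuous_on UNIV (\<lambda>p. g p i j)" for i j
    using g unfolding riemannian_metric_def smooth_fun_def by (metis times_cont_diff.simps(1))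
  then have "continuous_on S (\<lambda>t. g (c t) i j)" for i j
    using assms(2) by (rule continuous_on_compose2) auto
  then have "continuous_on S (\<lambda>t. \<Sum>i\<in>Basis. \<Sum>j\<in>Basis. (u t \<bullet> i) * (v t \<bullet> j) * g (c t) i j)"
    using assms by (intro continuous_intros)
  moreover have "g (c t) (u t) (v t) = (\<Sum>i\<in>Basis. \<Sum>j\<in>Basis. (u t \<bullet> i) * (v t \<bullet> j) * g (c t) i j)" for t
    using g by (intro bilinear_eq_sum) (simp add: riemannian_metric_def)
  ultimately show ?thesis by simp
qed

locale uniformly_positive_metric =
  fixes g :: "'a::euclidean_space \<Rightarrow> 'a \<Rightarrow> 'a \<Rightarrow> real" and m :: real
  assumes metric: "riemannian_metric g"
    and m_pos: "0 < m"
    and lower: "m * norm v \<le> sqrt (g p v v)"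
begin

text \<open>Up to the endpoints the speed equals a continuous function built from \<open>c'\<close>,
  hence is integrable. The length dominates the chord since the norm of the integral of
  \<open>m *\<^sub>R c'\<close> is at most the integral of its norm, which \<open>lower\<close>
  bounds by the speed.\<close>

lemma C1_speed_has_integral:
  assumes "a < b" "C1_curve_on a b c"
  shows "\<exists>i. (speed g c has_integral i) {a..b} \<and> m * norm (c b - c a) \<le> i"
proof -
  from assms obtain c' where c': "continuous_on {a..b} c'"
    "\<And>t. t \<in> {a..b} \<Longrightarrow> (c has_vector_derivative c' t) (at t within {a..b})"
    unfolding C1_curve_on_def by blast
  define f where "f t = sqrt (g (c t) (c' t) (c' t))" for t
  have "continuous_on {a..b} c"
    using c'(2) by (metis continuous_on_vector_derivative)
  then have f: "continuous_on {a..b} f"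
    unfolding f_def using c'(1)
    by (intro continuous_intros continuous_on_riemannian_metric[OF metric])
  then have f_int: "f integrable_on {a..b}" by (rule integrable_continuous_real)
  have "(speed g c has_integral integral {a..b} f) {a..b}"
  proof (rule has_integral_spike_finite[OF _ _ integrable_integral[OF f_int]])
    fix t assume "t \<in> {a..b} - {a, b}"
    then have "vector_derivative c (at t) = c' t"
      using c'(2)[of t] at_within_Icc_at[of a t b] by (auto intro: vector_derivative_at)
    then show "speed g c t = f t" by (simp add: speed_def f_def)
  qed auto
  moreover have "m * norm (c b - c a) \<le> integral {a..b} f"
  proof -
    have *: "((\<lambda>t. m *\<^sub>R c' t) has_integral m *\<^sub>R (c b - c a)) {a..b}"
      using assms(1) c'(2)
      by (intro has_integral_cmul fundamental_theorem_of_calculus) auto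
    have "norm (integral {a..b} (\<lambda>t. m *\<^sub>R c' t)) \<le> integral {a..b} f"
      using m_pos by (intro integral_norm_bound_integral f_int has_integral_integrable[OF *])
        (auto simp: f_def lower)
    then show ?thesis using m_pos by (simp only: integral_unique[OF *]) simp
  qed
  ultimately show ?thesis by blast
qed

lemma speed_has_integral:
  assumes "pw_C1_on c a b"
  shows "\<exists>i. (speed g c has_integral i) {a..b} \<and> m * norm (c b - c a) \<le> i"
  using assms
proof (induction rule: pw_C1_on.induct)
  case (piece a b)
  then show ?case by (rule C1_speed_has_integral)
next
  case (join a b d)
  then obtain i j where ij: "(speed g c has_integral i) {a..b}" "m * norm (c b - c a) \<le> i"
    "(speed g c has_integral j) {b..d}" "m * norm (c d - c b) \<le> j"
    by blast
  have "a \<le> b" "b \<le> d" using join by (auto dest: pw_C1_on_less)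
  then have "(speed g c has_integral i + j) {a..d}"
    using ij by (intro has_integral_combine)
  moreover have "m * norm (c d - c a) \<le> i + j"
  proof -
    have "norm (c d - c a) \<le> norm (c b - c a) + norm (c d - c b)"
      using norm_triangle_ineq[of "c b - c a" "c d - c b"] by simp
    then have "m * norm (c d - c a) \<le> m * (norm (c b - c a) + norm (c d - c b))"
      using m_pos by simp
    then show ?thesis using ij by (simp add: distrib_left)
  qed
  ultimately show ?case by blast
qed

section \<open>The Riemannian distance as a metric\<close>

definition curve_lengths :: "'a \<Rightarrow> 'a \<Rightarrow> real set" where
  "curve_lengths p q = {riemannian_length g c | c. piecewise_C1_curve c \<and> c 0 = p \<and> c 1 = q}"

lemma dist_eq: "riemannian_dist g p q = Inf (curve_lengths p q)"
  by (simp add: riemannian_dist_def curve_lengths_def)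

text \<open>Using \<open>has_integral\<close> carries the existence of the integral along, so that
  lengths can be added without separate integrability conditions.\<close>

lemma curve_lengths_iff:
  "i \<in> curve_lengths p q \<longleftrightarrow>
     (\<exists>c. pw_C1_on c 0 1 \<and> c 0 = p \<and> c 1 = q \<and> (speed g c has_integral i) {0..1})"
proof -
  have "(speed g c has_integral i) {0..1} \<longleftrightarrow> i = riemannian_length g c" if "pw_C1_on c 0 1" for c
    using speed_has_integral[OF that] by (auto simp: riemannian_length_speed integral_unique)
  then show ?thesis
    unfolding curve_lengths_def piecewise_C1_curve_iff by blast
qed

lemma curve_lengths_lower: "i \<in> curve_lengths p q \<Longrightarrow> m * norm (q - p) \<le> i"
  unfolding curve_lengths_iff by (auto dest: speed_has_integral has_integral_unique)

lemma bdd_below_curve_lengths: "bdd_below (curve_lengths p q)"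
  by (rule bdd_belowI) (rule curve_lengths_lower)

text \<open>The straight segment shows that the set of lengths is nonempty, as needed for infima,
  and yields the upper bounds for the distance.\<close>

lemma segment_length:
  "integral {0..1} (\<lambda>t. sqrt (g (p + t *\<^sub>R (q - p)) (q - p) (q - p))) \<in> curve_lengths p q"
proof -
  define c where "c t = p + t *\<^sub>R (q - p)" for t
  have d: "(c has_vector_derivative (q - p)) F" if "F = at t within S" for t S F
    unfolding c_def that by (auto intro!: derivative_eq_intros)
  have "C1_curve_on 0 1 c"
    unfolding C1_curve_on_def using d by (intro exI[of _ "\<lambda>_. q - p"]) auto
  then have c: "pw_C1_on c 0 1" by (simp add: piece)
  have "vector_derivative c (at t) = q - p" for t
    using d by (blast intro: vector_derivative_at)
  then have "speed g c = (\<lambda>t. sqrt (g (p + t *\<^sub>R (q - p)) (q - p) (q - p)))"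
    by (auto simp: speed_def c_def)
  then show ?thesis
    using c speed_has_integral[OF c] unfolding curve_lengths_iff
    by (intro exI[of _ c]) (auto simp: c_def integral_unique)
qed

lemma dist_le: "i \<in> curve_lengths p q \<Longrightarrow> riemannian_dist g p q \<le> i"
  unfolding dist_eq by (rule cInf_lower) (auto intro: bdd_below_curve_lengths)

lemma dist_lower: "m * norm (q - p) \<le> riemannian_dist g p q"
  unfolding dist_eq using segment_length[of p q] curve_lengths_lower by (intro cInf_greatest) auto

lemma bilinear: "bilinear (g p)"
  using metric by (simp add: riemannian_metric_def)

text \<open>Curves are reversed by \<open>t \<mapsto> 1 - t\<close>; equality of the two sets
  follows by exchanging \<open>p\<close> and \<open>q\<close>.\<close>

lemma curve_lengths_sym: "curve_lengths p q \<subseteq> curve_lengths q p"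
proof
  fix i assume "i \<in> curve_lengths p q"
  then obtain c where c: "pw_C1_on c 0 1" "c 0 = p" "c 1 = q" "(speed g c has_integral i) {0..1}"
    unfolding curve_lengths_iff by blast
  have "(\<lambda>t::real. 1 - t) ` {0..1} = {0..1}"
    by (simp add: image_diff_atLeastAtMost)
  moreover have "(\<lambda>t::real. (t - 1) / - 1) = (\<lambda>t. 1 - t)" by auto
  ultimately have "(speed g (\<lambda>t. c (- 1 * t + 1)) has_integral i) {0..1}"
    using speed_affine_has_integral[OF bilinear c(1) _ c(4), of "- 1" 1] by simp
  moreover have "pw_C1_on (\<lambda>t. c (- 1 * t + 1)) 0 1"
    using pw_C1_on_affine_neg[OF c(1), of "- 1" 1] by simp
  ultimately show "i \<in> curve_lengths q p"
    unfolding curve_lengths_iff using c by (intro exI[of _ "\<lambda>t. c (- 1 * t + 1)"]) auto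
qed

text \<open>Lengths add under concatenation; each half of \<open>c +++ d\<close> is an affine copy
  of slope 2 of one of the curves.\<close>

lemma curve_lengths_add:
  assumes "i \<in> curve_lengths p q" "j \<in> curve_lengths q r"
  shows "i + j \<in> curve_lengths p r"
proof -
  from assms obtain c d where c: "pw_C1_on c 0 1" "c 0 = p" "c 1 = q" "(speed g c has_integral i) {0..1}"
    and d: "pw_C1_on d 0 1" "d 0 = q" "d 1 = r" "(speed g d has_integral j) {0..1}"
    unfolding curve_lengths_iff by blast
  have e1: "t \<in> {0..1/2} \<Longrightarrow> c (2 * t + 0) = (c +++ d) t" for t
    by (simp add: joinpaths_def)
  \<comment> \<open>At \<open>t = 1/2\<close> the concatenation takes its value from
    \<open>c\<close>, which is \<open>c 1 = q = d 0\<close>.\<close>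
  have e2: "t \<in> {1/2..1} \<Longrightarrow> d (2 * t + - 1) = (c +++ d) t" for t
  proof (cases "t = 1/2")
    case True
    then show ?thesis using c d unfolding True by (simp add: joinpaths_def)
  qed (auto simp: joinpaths_def)
  have "pw_C1_on (c +++ d) 0 (1/2)"
    using pw_C1_on_cong[OF _ e1] pw_C1_on_affine_pos[OF c(1), of 2 0] by simp
  moreover have "pw_C1_on (c +++ d) (1/2) 1"
    using pw_C1_on_cong[OF _ e2] pw_C1_on_affine_pos[OF d(1), of 2 "- 1"] by simp
  ultimately have cd: "pw_C1_on (c +++ d) 0 1" by (rule join)
  have im: "(\<lambda>t::real. (t - 0) / 2) ` {0..1} = {0..1/2}" "(\<lambda>t::real. (t - - 1) / 2) ` {0..1} = {1/2..1}"
    using image_affinity_atLeastAtMost_div[of 2 0 0 "1::real"]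
      image_affinity_atLeastAtMost_div[of 2 "1/2" 0 "1::real"]
    by (simp_all add: add_divide_distrib)
  have "(speed g (c +++ d) has_integral i) {0..1/2}"
    by (rule speed_has_integral_cong[OF _ e1])
      (use speed_affine_has_integral[OF bilinear c(1) _ c(4), of 2 0] im(1) in \<open>simp_all\<close>)
  moreover have "(speed g (c +++ d) has_integral j) {1/2..1}"
    by (rule speed_has_integral_cong[OF _ e2])
      (use speed_affine_has_integral[OF bilinear d(1) _ d(4), of 2 "- 1"] im(2) in \<open>simp_all\<close>)
  ultimately have "(speed g (c +++ d) has_integral i + j) {0..1}"
    by (intro has_integral_combine[of 0 "1/2" 1]) auto
  then show ?thesis
    unfolding curve_lengths_iff using cd c d
    by (intro exI[of _ "c +++ d"]) (auto simp: joinpaths_def)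
qed

lemma dist_self: "riemannian_dist g p p = 0"
proof -
  have "riemannian_dist g p p \<le> 0"
    using dist_le[OF segment_length[of p p]] bilinear by (simp add: bilinear_lzero)
  then show ?thesis using dist_lower[of p p] by simp
qed

lemma dist_triangle: "riemannian_dist g p r \<le> riemannian_dist g p q + riemannian_dist g q r"
proof -
  \<comment> \<open>With the first curve fixed, take the infimum over the second one; the infimum
    over the first one follows.\<close>
  have "riemannian_dist g p r - i \<le> riemannian_dist g q r" if "i \<in> curve_lengths p q" for i
    unfolding dist_eq[of q r]
  proof (rule cInf_greatest)
    show "curve_lengths q r \<noteq> {}" using segment_length by blast
    show "riemannian_dist g p r - i \<le> j" if "j \<in> curve_lengths q r" for j
      using dist_le[OF curve_lengths_add[OF \<open>i \<in> curve_lengths p q\<close> that]] by simp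
  qed
  then have "riemannian_dist g p r - riemannian_dist g q r \<le> riemannian_dist g p q"
    unfolding dist_eq[of p q] using segment_length[of p q]
    by (intro cInf_greatest) (auto simp: diff_le_eq add.commute)
  then show ?thesis by simp
qed

lemma Metric_space: "Metric_space UNIV (riemannian_dist g)"
proof
  show "0 \<le> riemannian_dist g p q" for p q
    using dist_lower[of q p] m_pos by (meson dual_order.trans less_imp_le mult_nonneg_nonneg norm_ge_zero)
  show "riemannian_dist g p q = riemannian_dist g q p" for p q
    unfolding dist_eq using curve_lengths_sym by (metis subset_antisym)
  show "(riemannian_dist g p q = 0) = (p = q)" for p q
  proof
    assume "riemannian_dist g p q = 0"
    then have "m * norm (q - p) \<le> 0" using dist_lower[where p = p and q = q] by simp
    then show "p = q" using m_pos by (simp add: mult_le_0_iff)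
  qed (simp add: dist_self)
  show "riemannian_dist g p r \<le> riemannian_dist g p q + riemannian_dist g q r" for p q r
    by (rule dist_triangle)
qed

lemma dist_upper: "\<exists>K. \<forall>q\<in>cball p 1. riemannian_dist g p q \<le> K * norm (q - p)"
proof -
  \<comment> \<open>\<open>K\<close> is a bound for the metric norm of Euclidean unit vectors at
    points of the compact unit ball around \<open>p\<close>.\<close>
  have "continuous_on (cball p 1 \<times> sphere 0 1) (\<lambda>x. sqrt (g (fst x) (snd x) (snd x)))"
    by (intro continuous_intros continuous_on_riemannian_metric[OF metric])
  then have "bounded ((\<lambda>x. sqrt (g (fst x) (snd x) (snd x))) ` (cball p 1 \<times> sphere 0 1))"
    by (intro compact_imp_bounded compact_continuous_image compact_Times) auto
  then obtain K where K: "\<And>x v. x \<in> cball p 1 \<Longrightarrow> v \<in> sphere 0 1 \<Longrightarrow> sqrt (g x v v) \<le> K"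
    unfolding bounded_iff by (force dest: abs_le_D1)
  have "riemannian_dist g p q \<le> K * norm (q - p)" if q: "q \<in> cball p 1" for q
  proof -
    \<comment> \<open>The unit vector towards \<open>q\<close>, or 0 if \<open>q = p\<close>; the
      bound \<open>K\<close> scales from \<open>v\<close> to \<open>q - p\<close> along the segment,
      which stays in the ball.\<close>
    define v where "v = sgn (q - p)"
    have v: "q - p = norm (q - p) *\<^sub>R v"
      by (cases "q = p") (simp_all add: v_def sgn_div_norm)
    have le: "sqrt (g (p + t *\<^sub>R (q - p)) (q - p) (q - p)) \<le> K * norm (q - p)" if "t \<in> {0..1}" for t
    proof (cases "q = p")
      case True
      then show ?thesis using bilinear by (simp add: bilinear_lzero)
    next
      case False
      have "norm (t *\<^sub>R (q - p)) \<le> 1 * 1"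
        using that q unfolding norm_scaleR by (intro mult_mono) (auto simp: dist_norm norm_minus_commute)
      then have "p + t *\<^sub>R (q - p) \<in> cball p 1" by (simp add: dist_norm)
      moreover have "v \<in> sphere 0 1" using False by (simp add: v_def norm_sgn)
      ultimately have "sqrt (g (p + t *\<^sub>R (q - p)) v v) \<le> K" by (rule K)
      moreover have "sqrt (g x (q - p) (q - p)) = norm (q - p) * sqrt (g x v v)" for x
        by (subst (1 2) v) (simp add: bilinear_lmul[OF bilinear] bilinear_rmul[OF bilinear] real_sqrt_mult
              flip: mult.assoc)
      ultimately show ?thesis by (simp add: mult.commute[of K] mult_left_mono)
    qed
    have "riemannian_dist g p q \<le> integral {0..1} (\<lambda>t. sqrt (g (p + t *\<^sub>R (q - p)) (q - p) (q - p)))"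
      by (rule dist_le[OF segment_length])
    also have "\<dots> \<le> integral {0..1} (\<lambda>t::real. K * norm (q - p))"
      by (intro integral_le le integrable_continuous_real continuous_intros
          continuous_on_riemannian_metric[OF metric])
    finally show ?thesis by simp
  qed
  then show ?thesis by blast
qed

theorem complete: "complete_riemannian_metric g"
proof -
  interpret M: Metric_space UNIV "riemannian_dist g" by (rule Metric_space)
  have "\<exists>p. limitin M.mtopology \<sigma> p sequentially" if \<sigma>: "M.MCauchy \<sigma>" for \<sigma>
  proof -
    have "Cauchy \<sigma>"
    proof (rule metric_CauchyI)
      fix e :: real assume "0 < e"
      \<comment> \<open>The bound \<open>dist_lower\<close> loses a factor \<open>m\<close>, hence
        the tolerance \<open>m * e\<close>.\<close>
      then have "0 < m * e" using m_pos by simp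
      then obtain N where N: "\<And>n n'. n \<ge> N \<Longrightarrow> n' \<ge> N \<Longrightarrow> riemannian_dist g (\<sigma> n) (\<sigma> n') < m * e"
        using \<sigma> unfolding M.MCauchy_def by blast
      have "dist (\<sigma> n) (\<sigma> n') < e" if "n \<ge> N" "n' \<ge> N" for n n'
      proof -
        have "m * norm (\<sigma> n' - \<sigma> n) < m * e"
          using dist_lower N[OF that] by (rule order_le_less_trans)
        then show ?thesis
          using m_pos by (simp add: dist_norm norm_minus_commute)
      qed
      then show "\<exists>N. \<forall>n\<ge>N. \<forall>n'\<ge>N. dist (\<sigma> n) (\<sigma> n') < e" by blast
    qed
    then obtain p where p: "\<sigma> \<longlonglongrightarrow> p"
      using Cauchy_convergent convergentD by blast
    obtain K where K: "\<forall>q\<in>cball p 1. riemannian_dist g p q \<le> K * norm (q - p)"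
      using dist_upper by blast
    have "(\<lambda>n. riemannian_dist g (\<sigma> n) p) \<longlonglongrightarrow> 0"
    proof (rule tendsto_sandwich)
      show "\<forall>\<^sub>F n in sequentially. 0 \<le> riemannian_dist g (\<sigma> n) p"
        by simp
      have "\<forall>\<^sub>F n in sequentially. dist (\<sigma> n) p < 1"
        using tendstoD[OF p] by simp
      then show "\<forall>\<^sub>F n in sequentially. riemannian_dist g (\<sigma> n) p \<le> K * norm (\<sigma> n - p)"
        by eventually_elim (use K in \<open>auto simp: M.commute[of _ p] dist_commute\<close>)
      have "(\<lambda>n. K * norm (\<sigma> n - p)) \<longlonglongrightarrow> K * norm (p - p)"
        by (intro tendsto_intros p)
      then show "(\<lambda>n. K * norm (\<sigma> n - p)) \<longlonglongrightarrow> 0" by simp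
    qed auto
    then have "limitin M.mtopology \<sigma> p sequentially"
      unfolding M.limitin_metric_dist_null by simp
    then show ?thesis by blast
  qed
  then show ?thesis
    using metric by (simp add: complete_riemannian_metric_def M.mcomplete_def)
qed

end

section \<open>Smoothness from closure under differentiation\<close>

text \<open>By the mean value theorem the difference quotient at \<open>a\<close> is a value of
  \<open>g\<close> at a nearby point. This is used at the origin, where the profile and its
  derivative are defined by cases.\<close>

lemma has_real_derivative_removable:
  fixes f g :: "real \<Rightarrow> real"
  assumes "\<And>x. x \<noteq> a \<Longrightarrow> (f has_real_derivative g x) (at x)" "isCont f a" "isCont g a"
  shows "(f has_real_derivative g a) (at a)"
  unfolding has_field_derivative_iff
proof (rule tendstoI)
  fix e :: real assume "0 < e"
  with assms(3) obtain d where d: "0 < d" "\<And>x. dist x a < d \<Longrightarrow> dist (g x) (g a) < e"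
    unfolding continuous_at_eps_delta by (metis dist_commute)
  have "dist ((f x - f a) / (x - a)) (g a) < e" if x: "x \<noteq> a" "dist x a < d" for x
  proof -
    have cont: "isCont f t" for t
      using assms(1,2) DERIV_isCont by (cases "t = a") auto
    \<comment> \<open>The minimum and maximum treat points on both sides of \<open>a\<close> at
      once.\<close>
    obtain z where z: "min x a < z" "z < max x a" "f (max x a) - f (min x a) = (max x a - min x a) * g z"
    proof -
      have "\<exists>l z. min x a < z \<and> z < max x a \<and> (f has_real_derivative l) (at z) \<and>
          f (max x a) - f (min x a) = (max x a - min x a) * l"
      proof (rule MVT)
        show "min x a < max x a" using x(1) by (auto simp: min_def max_def)
        show "continuous_on {min x a..max x a} f" using cont by (simp add: continuous_at_imp_continuous_on)
        show "f differentiable (at t)" if "min x a < t" "t < max x a" for t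
          using assms(1)[of t] that by (auto simp: real_differentiable_def min_def max_def split: if_splits)
      qed
      then obtain l z where "min x a < z" "z < max x a" "(f has_real_derivative l) (at z)"
          "f (max x a) - f (min x a) = (max x a - min x a) * l"
        by blast
      moreover from this have "l = g z"
        by (intro DERIV_unique[OF _ assms(1)]) auto
      ultimately show ?thesis using that by blast
    qed
    have "(f x - f a) / (x - a) = g z"
      using z x(1) by (cases "x < a") (auto simp: field_simps min_def max_def)
    moreover have "dist z a < d"
      using z x by (auto simp: dist_real_def min_def max_def split: if_splits)
    ultimately show ?thesis using d by simp
  qed
  then show "\<forall>\<^sub>F x in at a. dist ((f x - f a) / (x - a)) (g a) < e"
    unfolding eventually_at using d(1) by auto
qed

text \<open>Induction on the order, for all members of \<open>F\<close> simultaneously: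
  differentiability gives continuity at order 0, and partial derivatives stay in
  \<open>F\<close>.\<close>

lemma smooth_funI:
  fixes F :: "('a::euclidean_space \<Rightarrow> real) set"
  assumes "\<And>f x. f \<in> F \<Longrightarrow> f differentiable (at x)"
    and "\<And>f b. f \<in> F \<Longrightarrow> b \<in> Basis \<Longrightarrow> (\<lambda>x. frechet_derivative f (at x) b) \<in> F"
    and "f \<in> F"
  shows "smooth_fun f"
proof -
  have "times_cont_diff k f" if "f \<in> F" for k f
    using that
  proof (induction k arbitrary: f)
    case 0
    then show ?case
      using assms(1) by (auto intro!: differentiable_imp_continuous_on simp: differentiable_on_def
          intro: differentiable_at_withinI)
  next
    case (Suc k)
    then show ?case using assms(1,2) by auto
  qed
  then show ?thesis using assms(3) by (simp add: smooth_fun_def)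
qed

section \<open>The profile function\<close>

text \<open>The quotient of \<open>T_fun C x\<close> by \<open>x\<^sup>2\<close>. It is strictly
  decreasing on the positive axis for every \<open>C\<close>, whereas \<open>T_fun\<close> is not
  when \<open>C > 0\<close>; this gives uniqueness of the zero and the sign before it.\<close>

definition T_ratio :: "real \<Rightarrow> real \<Rightarrow> real" where
  "T_ratio C x = C - x powr (2/3) + 3 / x\<^sup>2"

lemma T_fun_eq: "0 < x \<Longrightarrow> T_fun C x = x\<^sup>2 * T_ratio C x"
proof -
  assume "0 < x"
  have "x powr (8/3) = x powr (2 + 2/3)" by simp
  also have "\<dots> = x\<^sup>2 * x powr (2/3)"
    using \<open>0 < x\<close> by (simp only: powr_add) simp
  finally show ?thesis using \<open>0 < x\<close> by (simp add: T_fun_def T_ratio_def field_simps)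
qed

text \<open>Only the power with exponent \<open>2/3\<close> is discarded. With \<open>y\<close> the
  zero, the explicit gap bounds \<open>T_fun\<close> from below near it.\<close>

lemma T_ratio_gap: "0 < x \<Longrightarrow> x < y \<Longrightarrow> T_ratio C y + (3 / x\<^sup>2 - 3 / y\<^sup>2) < T_ratio C x"
  by (simp add: T_ratio_def powr_less_mono2)

lemma T_ratio_less: "0 < x \<Longrightarrow> x < y \<Longrightarrow> T_ratio C y < T_ratio C x"
proof -
  assume xy: "0 < x" "x < y"
  then have "3 / y\<^sup>2 < 3 / x\<^sup>2" by (intro divide_strict_left_mono power_strict_mono) auto
  then show ?thesis using T_ratio_gap[OF xy, of C] by simp
qed

lemma T_fun_root: "\<exists>x>0. T_fun C x = 0"
proof -
  define b where "b = \<bar>C\<bar> + 4"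
  have b: "4 \<le> b" "C \<le> b - 4" by (auto simp: b_def)
  \<comment> \<open>The exponent turns both powers of \<open>N\<close> into integer powers of
    \<open>b\<close>, and \<open>C \<le> b - 4\<close> makes the value at \<open>N\<close> negative.
    At 0 the value is 3, since \<open>0 powr (8/3) = 0\<close>.\<close>
  define N where "N = b powr (3/2)"
  have "N powr (8/3) = b ^ 4"
    using b by (simp add: N_def powr_powr)
  moreover have "N\<^sup>2 = b ^ 3"
    using b by (simp add: N_def power2_eq_square flip: powr_add)
  ultimately have "T_fun C N = b ^ 3 * (C - b) + 3"
    by (simp add: T_fun_def algebra_simps power_numeral_reduce)
  also have "b ^ 3 * (C - b) \<le> b ^ 3 * (- 4)"
    using b by (intro mult_left_mono) auto
  also have "\<dots> \<le> - 4"
    using one_le_power[of b 3] b by simp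
  finally have "T_fun C N \<le> 0" by simp
  moreover have "continuous_on {0..N} (T_fun C)"
    unfolding T_fun_def by (auto intro!: continuous_intros continuous_on_powr')
  moreover have "0 \<le> T_fun C 0" "0 \<le> N" by (auto simp: T_fun_def N_def)
  ultimately obtain x where "0 \<le> x" "T_fun C x = 0"
    using IVT2'[of "T_fun C" N 0 0] by auto
  moreover have "T_fun C 0 \<noteq> 0" by (simp add: T_fun_def)
  ultimately show ?thesis by (metis less_eq_real_def)
qed

lemma xi01_pos: "0 < xi01 C" and T_ratio_xi01: "T_ratio C (xi01 C) = 0"
proof -
  obtain x where x: "0 < x" "T_fun C x = 0" using T_fun_root by blast
  have *: "T_ratio C y = 0" if "0 < y" "T_fun C y = 0" for y
    using that by (simp add: T_fun_eq)
  have "xi01 C = x"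
    unfolding xi01_def
  proof (rule the_equality)
    fix y assume y: "0 < y \<and> T_fun C y = 0"
    then show "y = x"
      using *[of x] *[of y] x T_ratio_less[of x y C] T_ratio_less[of y x C]
      by (metis less_irrefl linorder_neqE_linordered_idom)
  qed (use x in simp)
  then show "0 < xi01 C" "T_ratio C (xi01 C) = 0" using x * by auto
qed

lemma T_ratio_pos: "0 < x \<Longrightarrow> x < xi01 C \<Longrightarrow> 0 < T_ratio C x"
  using T_ratio_less[of x "xi01 C" C] by (simp add: T_ratio_xi01)

lemma T_fun_pos: "0 < x \<Longrightarrow> x < xi01 C \<Longrightarrow> 0 < T_fun C x"
  using T_ratio_pos by (simp add: T_fun_eq)

section \<open>The integral \<open>rho\<close>: monotonicity, limit and range\<close>

locale profile =
  fixes C x0 :: real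
  assumes x0: "0 < x0" "x0 < xi01 C"
begin

abbreviation "b \<equiv> xi01 C"
abbreviation "r \<equiv> rho C x0"
abbreviation "r1 \<equiv> rho1 C x0"

definition rho_density :: "real \<Rightarrow> real" where
  "rho_density x = sqrt (3 / (x\<^sup>2 * T_fun C x))"

lemma rho_density_pos: "0 < x \<Longrightarrow> x < b \<Longrightarrow> 0 < rho_density x"
  using T_fun_pos by (simp add: rho_density_def)

lemma DERIV_rho:
  assumes x: "0 < x" "x < b"
  shows "(r has_real_derivative - rho_density x) (at x)"
proof -
  \<comment> \<open>A compact interval inside \<open>(0, b)\<close> that contains \<open>x0\<close>
    and has \<open>x\<close> in its interior, so the derivative within it is two-sided.\<close>
  define l u where "l = min x x0 / 2" and "u = (max x x0 + b) / 2"
  have lu: "0 < l" "l < x" "l \<le> x0" "x < u" "x0 \<le> u" "u < b"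
    using x x0 unfolding l_def u_def min_def max_def by (simp_all split: if_splits)
  have "continuous_on {l..u} (\<lambda>t. sqrt (3 / (t\<^sup>2 * T_fun C t)))"
    unfolding T_fun_def
  proof (intro continuous_intros ballI)
    fix t assume "t \<in> {l..u}"
    then have "0 < t" "t < b" using lu by auto
    then show "t\<^sup>2 * (- (t powr (8/3)) + C * t\<^sup>2 + 3) \<noteq> 0" "t \<noteq> 0"
      using T_fun_pos[of t C] by (auto simp: T_fun_def)
  qed
  from interval_integral_FTC2[OF lu(3,5) this, of x]
  have "((\<lambda>v. LBINT y=x0..v. sqrt (3 / (y\<^sup>2 * T_fun C y))) has_vector_derivative rho_density x)
        (at x within {l..u})"
    using lu by (simp add: rho_density_def)
  then have "((\<lambda>v. LBINT y=x0..v. sqrt (3 / (y\<^sup>2 * T_fun C y))) has_real_derivative rho_density x) (at x)"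
    using lu at_within_Icc_at[of l x u] by (simp add: has_real_derivative_iff_has_vector_derivative)
  then show ?thesis
    unfolding rho_def[abs_def] by (rule DERIV_minus)
qed

lemma isCont_rho: "0 < x \<Longrightarrow> x < b \<Longrightarrow> isCont r x"
  using DERIV_rho DERIV_isCont by blast

lemma rho_less: "0 < x \<Longrightarrow> x < y \<Longrightarrow> y < b \<Longrightarrow> r y < r x"
proof (rule DERIV_neg_imp_decreasing[of x y r])
  fix t assume "0 < x" "y < b" "x \<le> t" "t \<le> y"
  then show "\<exists>d. (r has_real_derivative d) (at t) \<and> d < 0"
    using DERIV_rho[of t] rho_density_pos[of t] by (intro exI[of _ "- rho_density t"]) auto
qed

text \<open>The right-hand side is minus the derivative of \<open>arcosh (b / x)\<close>; the comparison bounds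
  the improper integral near the simple zero \<^term>\<open>b\<close> of \<^term>\<open>T_fun C\<close>.\<close>

lemma rho_density_le_arcosh_deriv:
  assumes x: "0 < x" "x < b"
  shows "rho_density x \<le> b / (x\<^sup>2 * sqrt ((b / x)\<^sup>2 - 1))"
proof -
  have "3 / x\<^sup>2 - 3 / b\<^sup>2 \<le> T_ratio C x"
    using T_ratio_gap[of x b C] x by (simp add: T_ratio_xi01)
  then have "(x\<^sup>2)\<^sup>2 * (3 / x\<^sup>2 - 3 / b\<^sup>2) \<le> x\<^sup>2 * T_fun C x"
    using x by (simp add: T_fun_eq power2_eq_square mult_left_mono flip: mult.assoc)
  moreover have "0 < (x\<^sup>2)\<^sup>2 * (3 / x\<^sup>2 - 3 / b\<^sup>2)"
    using x by (simp add: divide_strict_left_mono power_strict_mono)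
  ultimately have "3 / (x\<^sup>2 * T_fun C x) \<le> 3 / ((x\<^sup>2)\<^sup>2 * (3 / x\<^sup>2 - 3 / b\<^sup>2))"
    by (intro divide_left_mono) (auto intro: mult_pos_pos order_less_le_trans)
  also have "\<dots> = (b / x\<^sup>2)\<^sup>2 / ((b / x)\<^sup>2 - 1)"
  proof -
    define d where "d = (b / x)\<^sup>2 - 1"
    have "3 / x\<^sup>2 - 3 / b\<^sup>2 = 3 * d / b\<^sup>2"
      using x by (simp add: d_def field_simps)
    then show ?thesis
      unfolding d_def[symmetric] by (simp add: power_divide)
  qed
  finally have "rho_density x \<le> sqrt ((b / x\<^sup>2)\<^sup>2 / ((b / x)\<^sup>2 - 1))"
    unfolding rho_density_def by simp
  also have "\<dots> = b / x\<^sup>2 / sqrt ((b / x)\<^sup>2 - 1)"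
    using x by (simp add: real_sqrt_divide)
  finally show ?thesis by (simp add: mult.commute)
qed

text \<open>The difference \<open>r x - arcosh (b / x)\<close> is nondecreasing by the preceding
  comparison, and \<open>r x0 = 0\<close>. Hence \<open>r\<close> stays bounded below up to
  \<open>b\<close>.\<close>

lemma rho_lower:
  assumes x: "x0 \<le> x" "x < b"
  shows "- arcosh (b / x0) \<le> r x"
proof -
  have "r x0 - arcosh (b / x0) \<le> r x - arcosh (b / x)"
  proof (rule DERIV_nonneg_imp_nondecreasing[OF x(1)])
    fix t assume t: "x0 \<le> t" "t \<le> x"
    then have t': "0 < t" "t < b" "1 < b / t" using x x0 by auto
    have "((\<lambda>t. b / t) has_real_derivative - b / t\<^sup>2) (at t)"
      using t' by (auto intro!: derivative_eq_intros simp: power2_eq_square)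
    from DERIV_diff[OF DERIV_rho[OF t'(1,2)] DERIV_chain2[OF arcosh_real_has_field_derivative[OF t'(3)] this]]
    have "((\<lambda>t. r t - arcosh (b / t)) has_real_derivative
           - rho_density t - 1 / sqrt ((b / t)\<^sup>2 - 1) * (- b / t\<^sup>2)) (at t)" .
    moreover have "0 \<le> - rho_density t - 1 / sqrt ((b / t)\<^sup>2 - 1) * (- b / t\<^sup>2)"
      using rho_density_le_arcosh_deriv[OF t'(1,2)] by (simp add: mult.commute)
    ultimately show "\<exists>y. ((\<lambda>t. r t - arcosh (b / t)) has_real_derivative y) (at t) \<and> 0 \<le> y"
      by blast
  qed
  moreover have "0 \<le> arcosh (b / x)" using x x0 by (intro arcosh_nonneg_real) auto
  moreover have "r x0 = 0" by (simp add: rho_def)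
  ultimately show ?thesis by simp
qed

lemma rho_tendsto_rho1: "(r \<longlongrightarrow> r1) (at_left b)"
  and rho1_less: "0 < x \<Longrightarrow> x < b \<Longrightarrow> r1 < r x"
proof -
  \<comment> \<open>A decreasing function bounded below tends to its infimum.\<close>
  define l where "l = Inf (r ` {x0..<b})"
  have bdd: "bdd_below (r ` {x0..<b})"
    by (rule bdd_belowI2[of _ "- arcosh (b / x0)"]) (simp add: rho_lower)
  have l: "l \<le> r x" if "x0 \<le> x" "x < b" for x
    unfolding l_def using bdd that by (intro cInf_lower) auto
  have lim: "(r \<longlongrightarrow> l) (at_left b)"
  proof (rule decreasing_tendsto)
    have "\<forall>\<^sub>F x in at_left b. x \<in> {x0<..<b}"
      using x0 by (intro eventually_at_left_real) auto
    then show "\<forall>\<^sub>F x in at_left b. l \<le> r x"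
      by eventually_elim (simp add: l)
    fix y assume "l < y"
    then obtain z where z: "x0 \<le> z" "z < b" "r z < y"
      using x0 bdd unfolding l_def by (subst (asm) cInf_less_iff) auto
    have "\<forall>\<^sub>F x in at_left b. x \<in> {z<..<b}"
      using z by (intro eventually_at_left_real) auto
    then show "\<forall>\<^sub>F x in at_left b. r x < y"
    proof eventually_elim
      case (elim x)
      then have "r x < r z" using z x0 by (intro rho_less) auto
      then show ?case using z by simp
    qed
  qed
  then have "r1 = l"
    unfolding rho1_def by (intro tendsto_Lim) auto
  then show "(r \<longlongrightarrow> r1) (at_left b)" using lim by simp
  show "r1 < r x" if x: "0 < x" "x < b"
  proof -
    \<comment> \<open>A point beyond \<open>x\<close> makes the inequality strict:
      \<open>r1 \<le> r y < r x\<close>.\<close>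
    define y where "y = (max x x0 + b) / 2"
    have "x < y" "x0 \<le> y" "y < b" using x x0 by (auto simp: y_def)
    then show ?thesis using l[of y] rho_less[of x y] x \<open>r1 = l\<close> by simp
  qed
qed

lemma rho_unbounded: "\<exists>x\<in>{0<..x0}. y \<le> r x"
proof -
  \<comment> \<open>\<open>3 * M\<close> bounds \<open>T_fun C\<close> on \<open>(0, b)\<close>. The
    density is thus at least \<open>k / t\<close>, and \<open>r\<close> grows at least
    logarithmically towards 0.\<close>
  define M where "M = 1 + \<bar>C\<bar> * b\<^sup>2 / 3"
  have M: "1 \<le> M" by (simp add: M_def)
  define k where "k = 1 / sqrt M"
  have k: "0 < k" using M by (simp add: k_def)
  have dens: "k / t \<le> rho_density t" if t: "0 < t" "t < b" for t
  proof -
    have "C * t\<^sup>2 \<le> \<bar>C\<bar> * t\<^sup>2" by (simp add: mult_right_mono)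
    also have "\<dots> \<le> \<bar>C\<bar> * b\<^sup>2" using t by (intro mult_left_mono power_mono) auto
    finally have "T_fun C t \<le> 3 * M"
      using powr_ge_zero[of t "8/3"] unfolding T_fun_def M_def by argo
    then have "t\<^sup>2 * T_fun C t \<le> t\<^sup>2 * (3 * M)" by (simp add: mult_left_mono)
    then have "3 / (t\<^sup>2 * (3 * M)) \<le> 3 / (t\<^sup>2 * T_fun C t)"
      using T_fun_pos[OF t] t M by (intro divide_left_mono mult_pos_pos) auto
    then have "sqrt (3 / (t\<^sup>2 * (3 * M))) \<le> rho_density t"
      unfolding rho_density_def by simp
    moreover have "sqrt (3 / (t\<^sup>2 * (3 * M))) = k / t"
      using t by (simp add: k_def real_sqrt_divide real_sqrt_mult mult.commute)
    ultimately show ?thesis by simp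
  qed
  have le: "k * ln (x0 / x) \<le> r x" if x: "0 < x" "x \<le> x0" for x
  proof -
    have "r x0 + k * ln x0 \<le> r x + k * ln x"
    proof (rule DERIV_nonpos_imp_nonincreasing[OF x(2)])
      fix t assume "x \<le> t" "t \<le> x0"
      then have t: "0 < t" "t < b" using x x0 by auto
      have "((\<lambda>t. r t + k * ln t) has_real_derivative - rho_density t + k * (1 / t)) (at t)"
        using t by (auto intro!: derivative_eq_intros DERIV_rho)
      then show "\<exists>y. ((\<lambda>t. r t + k * ln t) has_real_derivative y) (at t) \<and> y \<le> 0"
        using dens[OF t] by (intro exI conjI) auto
    qed
    moreover have "r x0 = 0" by (simp add: rho_def)
    ultimately show ?thesis using x x0 by (simp add: ln_div algebra_simps)
  qed
  \<comment> \<open>This solves \<open>k * ln (x0 / x) = \<bar>y\<bar>\<close>; the absolute value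
    ensures \<open>x \<le> x0\<close>.\<close>
  define x where "x = x0 * exp (- (\<bar>y\<bar> / k))"
  have "0 < x" "x \<le> x0" using x0 k by (auto simp: x_def mult_le_cancel_left1)
  moreover have "y \<le> r x"
    using le[OF \<open>0 < x\<close> \<open>x \<le> x0\<close>] k x0 by (simp add: x_def exp_minus field_simps)
  ultimately show ?thesis by auto
qed

text \<open>Intermediate values between a point near 0, where \<open>r\<close> is large, and a point
  near \<open>b\<close>, where \<open>r\<close> is close to \<open>r1\<close>.\<close>

lemma rho_surj:
  assumes "r1 < y"
  shows "\<exists>x. 0 < x \<and> x < b \<and> r x = y"
proof -
  obtain x where x: "0 < x" "x \<le> x0" "y \<le> r x" using rho_unbounded[of y] by auto
  have "\<forall>\<^sub>F z in at_left b. r z < y \<and> z \<in> {x0<..<b}"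
    using order_tendstoD(2)[OF rho_tendsto_rho1 assms] x0
    by (intro eventually_conj eventually_at_left_real) auto
  then obtain z where z: "r z < y" "x0 < z" "z < b"
    using eventually_happens[of _ "at_left b"] by auto
  have "\<exists>t. x \<le> t \<and> t \<le> z \<and> r t = y"
    using x z by (intro IVT2) (auto intro: isCont_rho)
  then obtain t where "x \<le> t" "t \<le> z" "r t = y" by blast
  then show ?thesis using x z by (intro exI[of _ t]) auto
qed

section \<open>The inverse function of \<open>rho\<close>\<close>

abbreviation "xi \<equiv> xi_of_rho C x0"

lemma inj_on_rho: "inj_on r {0<..<b}"
proof (rule linorder_inj_onI')
  fix x y assume "x \<in> {0<..<b}" "y \<in> {0<..<b}" "x < y"
  then have "r y < r x" by (intro rho_less) auto
  then show "r x \<noteq> r y" by simp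
qed

lemma xi_rho: "0 < x \<Longrightarrow> x < b \<Longrightarrow> xi (r x) = x"
  unfolding xi_of_rho_def using inj_on_rho by (intro the_inv_into_f_f) auto

lemma rho_xi: assumes "r1 < y" shows "0 < xi y" "xi y < b" "r (xi y) = y"
  using rho_surj[OF assms] xi_rho by auto

lemma isCont_xi:
  assumes "r1 < y"
  shows "isCont xi y"
proof -
  have "isCont xi (r (xi y))"
    using rho_xi[OF assms]
    by (intro isCont_inverse_function2[where f = r and a = "xi y / 2" and b = "(xi y + b) / 2"] xi_rho isCont_rho) auto
  then show ?thesis using rho_xi[OF assms] by simp
qed

lemma DERIV_xi:
  assumes "r1 < y"
  shows "(xi has_real_derivative - 1 / rho_density (xi y)) (at y)"
proof -
  note * = rho_xi[OF assms]
  have "(xi has_real_derivative inverse (- rho_density (xi y))) (at y)"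
    using DERIV_rho[OF *(1,2)] rho_density_pos[OF *(1,2)] isCont_xi[OF assms] assms
    by (intro DERIV_inverse_function[where f = r and a = r1 and b = "y + 1"]) (auto simp: rho_xi)
  then show ?thesis by (simp add: field_simps)
qed

lemma xi_tendsto: "((\<lambda>w. xi (w + r1)) \<longlongrightarrow> b) (at_right 0)"
proof (rule increasing_tendsto)
  have pos: "\<forall>\<^sub>F w in at_right 0. (0::real) < w"
    by (simp add: eventually_at_right_less)
  then show "\<forall>\<^sub>F w in at_right 0. xi (w + r1) \<le> b"
    by eventually_elim (simp add: rho_xi less_imp_le)
  fix y assume "y < b"
  \<comment> \<open>The given \<open>y\<close> may be nonpositive, so it is raised to a point of
    \<open>(0, b)\<close>, where monotonicity of \<open>r\<close> applies.\<close>
  define z where "z = max y (b / 2)"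
  have z: "0 < z" "z < b" "y \<le> z" using \<open>y < b\<close> xi01_pos[of C] by (auto simp: z_def)
  have "\<forall>\<^sub>F w in at_right 0. w \<in> {0<..<r z - r1}"
    using rho1_less[OF z(1,2)] by (intro eventually_at_right_real) auto
  then show "\<forall>\<^sub>F w in at_right 0. y < xi (w + r1)"
  proof eventually_elim
    case (elim w)
    then have w: "r1 < w + r1" "w + r1 < r z" by auto
    have "z < xi (w + r1)"
    proof (rule ccontr)
      assume "\<not> z < xi (w + r1)"
      then have "r z \<le> r (xi (w + r1))"
        using rho_less[of "xi (w + r1)" z] rho_xi[OF w(1)] z by force
      then show False using rho_xi[OF w(1)] w by simp
    qed
    then show ?case using z by simp
  qed
qed

section \<open>The even extension and its differential equation\<close>

abbreviation "G \<equiv> Gamma_fun C x0"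

lemma G_abs: "G w = (if w = 0 then 1 / b else 1 / xi (\<bar>w\<bar> + r1))"
  by (simp add: Gamma_fun_def h_fun_def)

lemma G_lower: "1 / b \<le> G w"
  using rho_xi[of "\<bar>w\<bar> + r1"] xi01_pos[of C]
  by (auto simp: G_abs intro!: divide_left_mono mult_pos_pos)

lemma G_pos: "0 < G w"
  using G_lower[of w] xi01_pos[of C] by (meson less_le_trans zero_less_divide_1_iff)

text \<open>The first integral of \<open>G'' = G + G powr (- 5/3) / 9\<close> is \<open>(G')\<^sup>2 = E G\<close>.\<close>

definition E :: "real \<Rightarrow> real" where
  "E y = (C - y powr (- 2/3) + 3 * y\<^sup>2) / 3"

text \<open>The first integral fixes the derivative of \<open>G\<close> only up to sign;
  \<open>G\<close> decreases to the left of the origin and increases to the right.\<close>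

definition dG :: "real \<Rightarrow> real" where
  "dG w = sgn w * sqrt (E (G w))"

text \<open>This transfers the sign of \<open>T_ratio\<close> and its zero at \<open>b\<close> to
  \<open>E\<close> along \<open>G\<close>.\<close>

lemma E_inverse: "0 < x \<Longrightarrow> E (1 / x) = T_ratio C x / 3"
  by (simp add: T_ratio_def E_def powr_minus powr_divide power_divide)

lemma E_pos: "w \<noteq> 0 \<Longrightarrow> 0 < E (G w)"
  using rho_xi[of "\<bar>w\<bar> + r1"] T_ratio_pos[of "xi (\<bar>w\<bar> + r1)" C] by (simp add: G_abs E_inverse)

lemma E_0: "E (G 0) = 0"
  using xi01_pos[of C] by (simp add: G_abs E_inverse T_ratio_xi01)

lemma DERIV_E: "0 < y \<Longrightarrow> (E has_real_derivative 2 * (y + y powr (- 5/3) / 9)) (at y)"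
  unfolding E_def by (auto intro!: derivative_eq_intros simp: field_simps)

lemma DERIV_G':
  assumes "w \<noteq> 0"
  shows "(G has_real_derivative dG w) (at w)"
proof -
  define x where "x = xi (\<bar>w\<bar> + r1)"
  have x: "0 < x" "x < b" using rho_xi[of "\<bar>w\<bar> + r1"] assms by (auto simp: x_def)
  have E: "E (G w) = T_ratio C x / 3"
    using assms x by (simp add: G_abs E_inverse x_def)
  \<comment> \<open>Here \<open>T_fun C x = 3 * x\<^sup>2 * E (G w)\<close>. The factor
    \<open>x\<^sup>2\<close> later cancels against the one from differentiating
    \<open>1 / xi\<close>.\<close>
  have "rho_density x = 1 / (x\<^sup>2 * sqrt (E (G w)))"
    unfolding rho_density_def
  proof (rule real_sqrt_unique)
    show "(1 / (x\<^sup>2 * sqrt (E (G w))))\<^sup>2 = 3 / (x\<^sup>2 * T_fun C x)"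
      using x E_pos[OF assms]
      by (simp add: T_fun_eq E power_divide power_mult_distrib flip: power_add power_mult)
  qed (use E_pos[OF assms] in simp)
  then have dens: "1 / rho_density x = x\<^sup>2 * sqrt (E (G w))" by simp
  have abs: "((\<lambda>w. \<bar>w\<bar> + r1) has_real_derivative sgn w) (at w)"
  proof -
    have "\<forall>\<^sub>F v in nhds w. v \<in> (if 0 < w then {0<..} else {..<0})"
      using assms by (intro eventually_nhds_in_open) auto
    then have "\<forall>\<^sub>F v in nhds w. \<bar>v\<bar> + r1 = sgn w * v + r1"
      by eventually_elim (use assms in \<open>auto split: if_splits\<close>)
    moreover have "((\<lambda>v. sgn w * v + r1) has_real_derivative sgn w) (at w)"
      by (auto intro!: derivative_eq_intros)
    ultimately show ?thesis by (subst DERIV_cong_ev) auto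
  qed
  have "((\<lambda>w. 1 / xi (\<bar>w\<bar> + r1)) has_real_derivative - (- 1 / rho_density x * sgn w / x\<^sup>2)) (at w)"
    using x assms DERIV_chain2[OF DERIV_xi abs]
    by (auto intro!: derivative_eq_intros simp: x_def power2_eq_square)
  moreover have "- (- 1 / rho_density x * sgn w / x\<^sup>2) = dG w"
    using x dens by (simp add: dG_def)
  ultimately have "((\<lambda>w. 1 / xi (\<bar>w\<bar> + r1)) has_real_derivative dG w) (at w)" by simp
  moreover have "\<forall>\<^sub>F v in nhds w. G v = 1 / xi (\<bar>v\<bar> + r1)"
    using t1_space_nhds[OF assms] by eventually_elim (simp add: G_abs)
  ultimately show ?thesis by (subst DERIV_cong_ev) auto
qed

text \<open>At the origin the limit from the right is that of \<open>1 / xi\<close>, and the limit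
  from the left follows by reflection.\<close>

lemma isCont_G: "isCont G w"
proof (cases "w = 0")
  case False
  then show ?thesis using DERIV_G' DERIV_isCont by blast
next
  case True
  have right: "((\<lambda>w. 1 / xi (w + r1)) \<longlongrightarrow> 1 / b) (at_right 0)"
    using xi_tendsto xi01_pos[of C] by (intro tendsto_intros) auto
  have "(G \<longlongrightarrow> 1 / b) (at_right 0)"
    by (rule Lim_transform_eventually[OF right])
      (auto simp: eventually_at_filter G_abs)
  moreover have "(G \<longlongrightarrow> 1 / b) (at_left 0)"
  proof -
    have "((\<lambda>w. 1 / xi (- w + r1)) \<longlongrightarrow> 1 / b) (at_left 0)"
      using right unfolding filterlim_at_left_to_right by simp
    then show ?thesis
      by (rule Lim_transform_eventually) (auto simp: eventually_at_filter G_abs)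
  qed
  ultimately show ?thesis
    using True by (simp add: isCont_def filterlim_split_at G_abs)
qed

lemma isCont_E_G: "isCont (\<lambda>w. E (G w)) w"
  using isCont_G DERIV_E[OF G_pos] by (metis DERIV_isCont isCont_o2)

lemma isCont_dG: "isCont dG w"
proof (cases "w = 0")
  case False
  have "isCont sgn w" using False isCont_sgn[of w "\<lambda>x. x"] by simp
  then show ?thesis unfolding dG_def[abs_def]
    using isCont_o2[OF isCont_E_G isCont_real_sqrt] by (intro isCont_mult)
next
  case True
  \<comment> \<open>\<open>sgn\<close> jumps at the origin, but \<open>dG\<close> is dominated by
    \<open>sqrt (E (G w))\<close>, which tends to 0 by \<open>E_0\<close>.\<close>
  have "((\<lambda>w. sqrt (E (G w))) \<longlongrightarrow> sqrt (E (G 0))) (at 0)"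
    using isCont_E_G[of 0] by (intro tendsto_intros) (simp add: isCont_def)
  then have "(dG \<longlongrightarrow> 0) (at 0)"
    by (intro Lim_null_comparison[of dG "\<lambda>w. sqrt (E (G w))"])
      (auto simp: dG_def abs_mult abs_sgn_eq eventually_at_filter E_0 E_pos less_imp_le intro!: always_eventually)
  then show ?thesis using True by (simp add: isCont_def dG_def)
qed

lemma DERIV_G: "(G has_real_derivative dG w) (at w)"
  using DERIV_G' has_real_derivative_removable[of 0 G dG, OF DERIV_G' isCont_G isCont_dG]
  by (cases "w = 0") auto

lemma DERIV_dG: "(dG has_real_derivative G w + G w powr (- 5/3) / 9) (at w)"
proof -
  define ddG where "ddG w = G w + G w powr (- 5/3) / 9" for w
  have "(dG has_real_derivative ddG w) (at w)" if w: "w \<noteq> 0" for w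
  proof -
    have "((\<lambda>w. E (G w)) has_real_derivative 2 * ddG w * dG w) (at w)"
      unfolding ddG_def by (rule DERIV_chain2[OF DERIV_E[OF G_pos] DERIV_G])
    from DERIV_real_sqrt[THEN DERIV_chain2, OF E_pos[OF w] this]
    have "((\<lambda>w. sqrt (E (G w))) has_real_derivative
        inverse (sqrt (E (G w))) / 2 * (2 * ddG w * dG w)) (at w)" .
    \<comment> \<open>The factor \<open>1 / sqrt (E (G w))\<close>, singular at the origin, cancels
      against the root in \<open>dG\<close>. The result is continuous there, so the formula extends
      to \<open>w = 0\<close>.\<close>
    moreover have "inverse (sqrt (E (G w))) / 2 * (2 * ddG w * dG w) = ddG w * sgn w"
      using E_pos[OF w] by (simp add: dG_def)
    ultimately have "((\<lambda>w. sqrt (E (G w))) has_real_derivative ddG w * sgn w) (at w)"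
      by (simp only:)
    then have "((\<lambda>v. sgn w * sqrt (E (G v))) has_real_derivative sgn w * (ddG w * sgn w)) (at w)"
      by (rule DERIV_cmult)
    moreover have "sgn w * (ddG w * sgn w) = ddG w"
      using w by (simp add: sgn_if)
    moreover have "\<forall>\<^sub>F v in nhds w. dG v = sgn w * sqrt (E (G v))"
    proof -
      have "\<forall>\<^sub>F v in nhds w. v \<in> (if 0 < w then {0<..} else {..<0})"
        using w by (intro eventually_nhds_in_open) auto
      then show ?thesis
        by eventually_elim (use w in \<open>auto simp: dG_def split: if_splits\<close>)
    qed
    ultimately show ?thesis by (subst DERIV_cong_ev) auto
  qed
  moreover have "isCont ddG 0"
    unfolding ddG_def using G_pos[of 0] by (intro continuous_intros isCont_G) auto
  ultimately have "(dG has_real_derivative ddG w) (at w)"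
    using has_real_derivative_removable[of 0 dG ddG, OF _ isCont_dG] by (cases "w = 0") auto
  then show ?thesis by (simp add: ddG_def)
qed

text \<open>Since \<open>G' = dG\<close> and \<open>dG' = G + G powr (- 5/3) / 9\<close>, this set is closed under differentiation.
  The coefficient 0 and the exponents 0 provide the constant functions.\<close>

inductive_set jets :: "(real \<Rightarrow> real) set" where
  monom: "(\<lambda>w. c * G w powr a * dG w ^ n) \<in> jets"
| add: "f \<in> jets \<Longrightarrow> g \<in> jets \<Longrightarrow> (\<lambda>w. f w + g w) \<in> jets"

lemma jets_deriv: "f \<in> jets \<Longrightarrow> \<exists>f'\<in>jets. \<forall>w. (f has_real_derivative f' w) (at w)"
proof (induction rule: jets.induct)
  case (monom c a n)
  \<comment> \<open>The last two terms come from the two summands of the derivative of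
    \<open>dG\<close>. For \<open>n = 0\<close> their coefficients vanish, so the truncated
    \<open>n - 1\<close> is harmless.\<close>
  define f' where "f' w = (c * a) * G w powr (a - 1) * dG w ^ (n + 1) +
      (c * n * G w powr (a + 1) * dG w ^ (n - 1) + c * n / 9 * G w powr (a - 5/3) * dG w ^ (n - 1))" for w
  have "f' \<in> jets" unfolding f'_def by (intro jets.intros)
  moreover have "((\<lambda>w. c * G w powr a * dG w ^ n) has_real_derivative f' w) (at w)" for w
  proof -
    have "((\<lambda>w. c * G w powr a * dG w ^ n) has_real_derivative
       c * (a * G w powr (a - 1) * dG w) * dG w ^ n +
       c * G w powr a * (n * dG w ^ (n - 1) * (G w + G w powr (- 5/3) / 9))) (at w)"
      using G_pos[of w]
      by (auto intro!: derivative_eq_intros DERIV_G DERIV_dG DERIV_fun_powr[THEN DERIV_cong])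
    moreover have "G w powr (a + 1) = G w powr a * G w" "G w powr (a - 5/3) = G w powr a * G w powr (- 5/3)"
      using G_pos[of w] by (simp_all add: powr_add powr_diff powr_minus_divide)
    ultimately show ?thesis
      by (simp add: f'_def algebra_simps)
  qed
  ultimately show ?case by blast
next
  case (add f g)
  then obtain f' g' where "f' \<in> jets" "\<forall>w. (f has_real_derivative f' w) (at w)"
    "g' \<in> jets" "\<forall>w. (g has_real_derivative g' w) (at w)" by blast
  then show ?case
    by (intro bexI[of _ "\<lambda>w. f' w + g' w"]) (auto intro: DERIV_add jets.add)
qed

lemma smooth_jets:
  assumes "f \<in> jets"
  shows "smooth_fun (\<lambda>p::real \<times> real. f (fst p))"
proof (rule smooth_funI)
  let ?F = "(\<lambda>f p. f (fst p :: real)) ` jets :: (real \<times> real \<Rightarrow> real) set"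
  have deriv: "\<exists>f'\<in>jets. \<forall>p::real \<times> real. ((\<lambda>p. f (fst p)) has_derivative (\<lambda>v. f' (fst p) * fst v)) (at p)"
    if f: "f \<in> jets" for f
  proof -
    obtain f' where f': "f' \<in> jets" "\<And>w. (f has_real_derivative f' w) (at w)"
      using jets_deriv[OF f] by blast
    then show ?thesis
      by (intro bexI[of _ f'] allI has_derivative_compose[of fst, OF _ f'(2)[unfolded has_field_derivative_def]])
        (auto intro!: derivative_eq_intros)
  qed
  show "h differentiable (at x)" if "h \<in> ?F" for h x
    using that deriv unfolding differentiable_def by blast
  show "(\<lambda>x. frechet_derivative h (at x) v) \<in> ?F" if h: "h \<in> ?F" and v: "v \<in> Basis" for h v
  proof -
    obtain f where f: "f \<in> jets" "h = (\<lambda>p. f (fst p))" using h by blast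
    obtain f' where f': "f' \<in> jets" "\<forall>p. (h has_derivative (\<lambda>v. f' (fst p) * fst v)) (at p)"
      using deriv[OF f(1)] f(2) by blast
    then have "frechet_derivative h (at p) = (\<lambda>v. f' (fst p) * fst v)" for p
      by (metis frechet_derivative_at)
    then have eq: "(\<lambda>x. frechet_derivative h (at x) v) = (\<lambda>x. f' (fst x) * fst v)" by simp
    \<comment> \<open>Along the first axis the partial derivative is the jet \<open>f'\<close>;
      along the second it is 0, a monomial with coefficient 0.\<close>
    have "v = (1, 0) \<or> v = (0, 1)" using v by (auto simp: Basis_prod_def)
    then show ?thesis
    proof
      assume "v = (1, 0)"
      then show ?thesis using f' eq by auto
    next
      assume "v = (0, 1)"
      then have "(\<lambda>x. frechet_derivative h (at x) v) = (\<lambda>f p. f (fst p)) (\<lambda>w. 0 * G w powr 0 * dG w ^ 0)"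
        using eq by simp
      then show ?thesis using monom[of 0 0 0] by (rule image_eqI)
    qed
  qed
  show "(\<lambda>p::real \<times> real. f (fst p)) \<in> ?F" using assms by blast
qed

section \<open>The metric on the plane\<close>

lemma riemannian_metric_g_tilde: "riemannian_metric (g_tilde C x0)"
  unfolding riemannian_metric_def
proof (intro conjI allI impI)
  show "bilinear (g_tilde C x0 p)" for p
    unfolding bilinear_def g_tilde_def by (auto intro!: linearI simp: algebra_simps)
  show "g_tilde C x0 p u v = g_tilde C x0 p v u" for p u v
    by (simp add: g_tilde_def mult.commute)
  show "0 < g_tilde C x0 p v v" if "v \<noteq> 0" for p v
  proof -
    have "fst v \<noteq> 0 \<or> snd v \<noteq> 0" using that by (simp add: prod_eq_iff)
    then show ?thesis
      using G_pos[of "fst p"] unfolding g_tilde_def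
      by (auto simp: add_pos_nonneg add_nonneg_pos zero_less_mult_iff simp flip: power2_eq_square)
  qed
  show "smooth_fun (\<lambda>p. g_tilde C x0 p u v)" for u v
  proof -
    \<comment> \<open>The metric coefficient as a sum of two monomials; \<open>G > 0\<close> makes
      \<open>G w powr 2\<close> the square and \<open>G w powr 0\<close> equal to 1.\<close>
    define f where "f w = (snd u * snd v) * G w powr 2 * dG w ^ 0 + (fst u * fst v) * G w powr 0 * dG w ^ 0" for w
    have "f \<in> jets" unfolding f_def by (intro jets.intros)
    moreover have "(\<lambda>p. g_tilde C x0 p u v) = (\<lambda>p. f (fst p))"
    proof
      fix p :: "real \<times> real"
      show "g_tilde C x0 p u v = f (fst p)" using G_pos[of "fst p"] by (simp add: f_def g_tilde_def mult.commute)
    qed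
    ultimately show ?thesis using smooth_jets by simp
  qed
qed

text \<open>The 1 in the minimum serves the first coordinate, whose coefficient is 1;
  \<open>1 / b\<close> serves the second, by \<open>G_lower\<close>.\<close>

lemma g_tilde_lower: "min 1 (1 / b) * norm v \<le> sqrt (g_tilde C x0 p v v)"
proof (rule real_le_rsqrt)
  define m where "m = min 1 (1 / b)"
  have m: "0 < m" "m \<le> 1" "m \<le> G (fst p)"
    using xi01_pos[of C] G_lower[of "fst p"] by (auto simp: m_def)
  then have "m\<^sup>2 \<le> 1" "m\<^sup>2 \<le> (G (fst p))\<^sup>2"
    by (auto intro: power_mono power_le_one)
  then have "m\<^sup>2 * (fst v)\<^sup>2 + m\<^sup>2 * (snd v)\<^sup>2 \<le> 1 * (fst v)\<^sup>2 + (G (fst p))\<^sup>2 * (snd v)\<^sup>2"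
    by (intro add_mono mult_right_mono) auto
  then show "(min 1 (1 / b) * norm v)\<^sup>2 \<le> g_tilde C x0 p v v"
    by (simp add: m_def[symmetric] g_tilde_def norm_prod_def power_mult_distrib distrib_left
        flip: power2_eq_square)
qed

end

section \<open>Completeness of the surface\<close>

theorem theorem3p6:
  fixes C xi00 :: real
  assumes "0 < xi00" and "xi00 < xi01 C"
  shows "complete_riemannian_metric (g_tilde C xi00)"
proof -
  interpret profile C xi00 by unfold_locales (use assms in auto)
  interpret uniformly_positive_metric "g_tilde C xi00" "min 1 (1 / xi01 C)"
    by unfold_locales (use riemannian_metric_g_tilde g_tilde_lower xi01_pos[of C] in auto)
  show ?thesis by (rule complete)
qed

end
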